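(* Let $n\ge 1$, let $U \subset \mathbb{R}$ be open, and suppose $\Gamma = (f_1,g_1, \dots, f_n,g_n,h) : U \to \mathbb{H}^n$ is $C^1$ and horizontal. Then for any compact $K \subset U$, $$\lim_{\substack{|b-a| \to 0 \\ a,b \in K}} \frac{\left|h(b)-h(a) - 2\sum_{j=1}^n (f_j(b)g_j(a) - f_j(a)g_j(b)) \right|}{|b-a|^2} = 0.$$
   Context: The Heisenberg group $\mathbb{H}^n$ is $\mathbb{R}^{2n+1}$ with coordinates $(x_1,y_1,\dots,x_n,y_n,t)$ and horizontal distribution spanned by $X_j = \partial_{x_j} + 2y_j\partial_t$, $Y_j = \partial_{y_j} - 2x_j\partial_t$, $j=1,\dots,n$. A $C^1$ curve $\Gamma=(f_1,g_1,\dots,f_n,g_n,h):U\to\mathbb{R}^{2n+1}$ ($C^1$ in the usual Euclidean sense) is horizontal if $\Gamma'(s)$ lies in the horizontal space at $\Gamma(s)$ for every $s\in U$, equivalently $h'(s)=2\sum_{j=1}^n(f_j'(s)g_j(s)-f_j(s)g_j'(s))$ for every $s\in U$. The limit as $|b-a|\to0$ with $a,b\in K$ is uniform: for every $\varepsilon>0$ there is $\delta>0$ such that the quotient is less than $\varepsilon$ for all $a,b\in K$ with $0<|b-a|<\delta$. *)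

theory Defs
  imports "HOL-Analysis.Analysis"
begin

(* H^n is R^(2n+1) with n = CARD('n), a positive number. The point (x_1,y_1,...,x_n,y_n,t) is the
   pair of the vector with j-th entry (x_j,y_j) and the real t. Topology, norm and linear
   structure are those of the product, i.e. the Euclidean ones. *)
type_synonym 'n heisenberg = "((real \<times> real) ^ 'n) \<times> real"

definition xcoord :: "'n::finite heisenberg \<Rightarrow> 'n \<Rightarrow> real" where
  "xcoord p j = fst (fst p $ j)"

definition ycoord :: "'n::finite heisenberg \<Rightarrow> 'n \<Rightarrow> real" where
  "ycoord p j = snd (fst p $ j)"

(* X_j = d/dx_j + 2 y_j d/dt and Y_j = d/dy_j - 2 x_j d/dt, evaluated at the point p *)
definition X_field :: "'n::finite \<Rightarrow> 'n heisenberg \<Rightarrow> 'n heisenberg" where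
  "X_field j p = (axis j (1, 0), 2 * ycoord p j)"

definition Y_field :: "'n::finite \<Rightarrow> 'n heisenberg \<Rightarrow> 'n heisenberg" where
  "Y_field j p = (axis j (0, 1), - 2 * xcoord p j)"

definition horizontal_space :: "'n::finite heisenberg \<Rightarrow> 'n heisenberg set" where
  "horizontal_space p = span (range (\<lambda>j. X_field j p) \<union> range (\<lambda>j. Y_field j p))"

(* Meant for curves differentiable on the open set U; vector_derivative is unspecified elsewhere. *)
definition horizontal_on :: "(real \<Rightarrow> 'n::finite heisenberg) \<Rightarrow> real set \<Rightarrow> bool" where
  "horizontal_on \<Gamma> U \<longleftrightarrow>
     (\<forall>s\<in>U. vector_derivative \<Gamma> (at s) \<in> horizontal_space (\<Gamma> s))"

end

(* Fix a in K. Writing p for the horizontal part of the curve and B for the alternating form with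
   h' = B(p', p), the numerator is F(b), where F(s) = h(s) - h(a) - B(p(s), p(a)) satisfies
   F(a) = 0 and F'(s) = B(p'(s), p(s) - p(a)) = B(p'(s), p(s) - p(a) - (s - a) p'(s)), since
   B(p', p') = 0. By uniform continuity of p' on a compact neighbourhood of K the second argument
   is o(|s - a|) uniformly in a, so F(b) = o(|b - a|^2) by the mean value inequality. *)

theory Submission
  imports Defs
begin

text \<open>The estimate for an arbitrary bounded alternating form \<open>B\<close>, so that
  coordinates enter only through \<open>heis_form\<close>. The non-strict bound also covers
  \<open>b = a\<close>, where both sides vanish.\<close>

lemma uniform_second_order_alternating:
  fixes B :: "'a::real_normed_vector \<Rightarrow> 'a \<Rightarrow> 'b::real_normed_vector"
    and p p' :: "real \<Rightarrow> 'a" and h :: "real \<Rightarrow> 'b"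
  assumes "bounded_bilinear B" and alt: "\<And>u. B u u = 0"
    and "open U" "compact K" "K \<subseteq> U"
    and p: "\<And>s. s \<in> U \<Longrightarrow> (p has_vector_derivative p' s) (at s)"
    and h: "\<And>s. s \<in> U \<Longrightarrow> (h has_vector_derivative B (p' s) (p s)) (at s)"
    and cont: "continuous_on U p'"
    and "\<epsilon> > 0"
  obtains \<delta> where "\<delta> > 0"
    and "\<And>a b. a \<in> K \<Longrightarrow> \<bar>b - a\<bar> < \<delta> \<Longrightarrow>
           norm (h b - h a - B (p b) (p a)) \<le> \<epsilon> * \<bar>b - a\<bar>\<^sup>2"
proof -
  interpret B: bounded_bilinear B by fact
  \<comment> \<open>Since \<open>K\<close> need not be convex, a segment joining two of its points
    may leave it. The mean value arguments therefore run in a compact neighbourhood \<open>N\<close>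
    of \<open>K\<close> inside \<open>U\<close>, where \<open>p'\<close> is bounded and uniformly
    continuous.\<close>
  obtain r where "r > 0" and rU: "(\<Union>x\<in>K. cball x r) \<subseteq> U"
    using compact_subset_open_imp_cball_epsilon_subset assms(3-5) by metis
  define N where "N = (\<Union>x\<in>K. cball x r)"
  have "compact N" "N \<subseteq> U"
    using compact_minkowski_sum_cball \<open>compact K\<close> rU by (auto simp: N_def)
  then have contN: "continuous_on N p'"
    using cont continuous_on_subset by blast
  then have "bounded (p' ` N)" 
    using \<open>compact N\<close> compact_continuous_image compact_imp_bounded by blast
  then obtain M where "M > 0" and M: "\<And>s. s \<in> N \<Longrightarrow> norm (p' s) \<le> M"
    by (auto simp: bounded_pos)
  obtain C where "C > 0" and C: "\<And>u v. norm (B u v) \<le> norm u * norm v * C"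
    using B.pos_bounded by blast
  \<comment> \<open>Chosen so that \<open>M * (\<bar>b - a\<bar> * \<omega>) * C\<close> equals
    \<open>\<epsilon> * \<bar>b - a\<bar>\<close>, the bound wanted for the derivative of
    \<open>F\<close>.\<close>
  define \<omega> where "\<omega> = \<epsilon> / (C * M)"
  have "\<omega> > 0" using \<open>\<epsilon> > 0\<close> \<open>C > 0\<close> \<open>M > 0\<close> by (simp add: \<omega>_def)
  then obtain d where "d > 0"
    and d: "\<And>s t. s \<in> N \<Longrightarrow> t \<in> N \<Longrightarrow> dist s t < d \<Longrightarrow> dist (p' s) (p' t) < \<omega>"
    using compact_uniformly_continuous[OF contN \<open>compact N\<close>]
    unfolding uniformly_continuous_on_def by metis
  show thesis
  proof (rule that[of "min r d"])
    show "min r d > 0" using \<open>r > 0\<close> \<open>d > 0\<close> by simp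
    fix a b assume "a \<in> K" and ab: "\<bar>b - a\<bar> < min r d"
    define S where "S = closed_segment a b"
    have dist_S: "\<bar>s - t\<bar> \<le> \<bar>b - a\<bar>" if "s \<in> S" "t \<in> S" for s t
      using that by (auto simp: S_def closed_segment_eq_real_ivl split: if_splits)
    have "a \<in> S" by (simp add: S_def)
    \<comment> \<open>Every point of the segment is within \<open>\<bar>b - a\<bar> < r\<close> of
      \<open>a\<close>, hence in the ball around \<open>a\<close>.\<close>
    have "S \<subseteq> N"
      using dist_S[OF \<open>a \<in> S\<close>] ab \<open>a \<in> K\<close> unfolding N_def
      by (fastforce simp: dist_real_def)
    \<comment> \<open>The increment from \<open>a\<close> to \<open>s\<close> is compared with the
      derivative at the endpoint \<open>s\<close>, not at \<open>a\<close>: this is the multiple of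
      \<open>p' s\<close> that \<open>alt\<close> annihilates below.\<close>
    have lin: "norm (p s - p a - (s - a) *\<^sub>R p' s) \<le> \<bar>b - a\<bar> * \<omega>" if "s \<in> S" for s
    proof -
      have "norm (p s - p a - (s - a) *\<^sub>R p' s) \<le> norm (s - a) * \<omega>"
      proof (rule vector_differentiable_bound_linearization[of S])
        show "closed_segment a s \<subseteq> S"
          using that by (simp add: S_def subset_closed_segment)
        show "norm (p' t - p' s) \<le> \<omega>" if "t \<in> S" for t
          using d[of t s] dist_S[OF that \<open>s \<in> S\<close>] \<open>S \<subseteq> N\<close> that \<open>s \<in> S\<close> ab
          by (force simp: dist_norm)
      qed (use that p \<open>S \<subseteq> N\<close> \<open>N \<subseteq> U\<close> in \<open>auto intro: has_vector_derivative_at_within\<close>)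
      also have "\<dots> \<le> \<bar>b - a\<bar> * \<omega>"
        using dist_S[OF that \<open>a \<in> S\<close>] \<open>\<omega> > 0\<close> by simp
      finally show ?thesis .
    qed
    define F where "F s = h s - h a - B (p s) (p a)" for s
    define F' where "F' s = B (p' s) (p s) - B (p' s) (p a)" for s
    have "F a = 0" by (simp add: F_def alt)
    have "F' a = 0" by (simp add: F'_def)
    \<comment> \<open>As \<open>F' a = 0\<close>, linearization at \<open>a\<close> reduces to the
      mean value inequality. A bound on \<open>F'\<close> of first order in
      \<open>\<bar>b - a\<bar>\<close> gives second order for \<open>F b\<close>.\<close>
    have "norm (F b - F a - (b - a) *\<^sub>R F' a) \<le> norm (b - a) * (\<epsilon> * \<bar>b - a\<bar>)"
    proof (rule vector_differentiable_bound_linearization[of S])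
      fix s assume "s \<in> S"
      then have "s \<in> U" using \<open>S \<subseteq> N\<close> \<open>N \<subseteq> U\<close> by blast
      have "(F has_vector_derivative F' s) (at s)"
        unfolding F_def F'_def
        by (auto intro!: derivative_eq_intros h[OF \<open>s \<in> U\<close>]
            bounded_linear.has_vector_derivative[OF B.bounded_linear_left] p[OF \<open>s \<in> U\<close>])
      then show "(F has_vector_derivative F' s) (at s within S)"
        by (rule has_vector_derivative_at_within)
      \<comment> \<open>The inserted term contributes
        \<open>(s - a) *\<^sub>R B (p' s) (p' s) = 0\<close>, so the second argument may be replaced
        by the small remainder from \<open>lin\<close>.\<close>
      have "F' s = B (p' s) (p s - p a - (s - a) *\<^sub>R p' s)"
        by (simp add: F'_def B.diff_right B.scaleR_right alt)
      then have "norm (F' s) \<le> norm (p' s) * norm (p s - p a - (s - a) *\<^sub>R p' s) * C"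
        using C by simp
      also have "\<dots> \<le> M * (\<bar>b - a\<bar> * \<omega>) * C"
        using M lin[OF \<open>s \<in> S\<close>] \<open>s \<in> S\<close> \<open>S \<subseteq> N\<close> \<open>C > 0\<close> \<open>M > 0\<close>
        by (intro mult_right_mono mult_mono) auto
      also have "\<dots> = \<epsilon> * \<bar>b - a\<bar>"
        using \<open>C > 0\<close> \<open>M > 0\<close> by (simp add: \<omega>_def)
      finally show "norm (F' s - F' a) \<le> \<epsilon> * \<bar>b - a\<bar>"
        by (simp add: \<open>F' a = 0\<close>)
    qed (use \<open>a \<in> S\<close> in \<open>auto simp: S_def\<close>)
    then show "norm (h b - h a - B (p b) (p a)) \<le> \<epsilon> * \<bar>b - a\<bar>\<^sup>2"
      by (simp add: \<open>F a = 0\<close> \<open>F' a = 0\<close> power2_eq_square mult_ac)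
        (simp add: F_def)
  qed
qed

text \<open>Twice the standard symplectic form on the horizontal coordinates. The order of arguments
  is such that horizontality reads h' = \<open>heis_form\<close> p' p.\<close>

definition heis_form :: "(real \<times> real) ^ 'n::finite \<Rightarrow> (real \<times> real) ^ 'n \<Rightarrow> real" where
  "heis_form u v = 2 * (\<Sum>j\<in>UNIV. fst (u $ j) * snd (v $ j) - fst (v $ j) * snd (u $ j))"

text \<open>In finite dimension bilinearity already implies boundedness.\<close>

lemma bounded_bilinear_heis_form: "bounded_bilinear (heis_form :: (real \<times> real) ^ 'n::finite \<Rightarrow> _)"
proof -
  have "bilinear (heis_form :: (real \<times> real) ^ 'n \<Rightarrow> _)"
    by (auto simp: bilinear_def linear_iff heis_form_def sum_distrib_left
        simp flip: sum.distrib intro!: sum.cong simp: algebra_simps)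
  then show ?thesis by (simp add: bilinear_conv_bounded_bilinear)
qed

lemma heis_form_self: "heis_form u u = 0"
  by (simp add: heis_form_def)

text \<open>Both sides are linear in \<open>w\<close>, so it suffices to check the spanning fields:
  pairing the j-th x-direction with \<open>fst q\<close> gives \<open>2 * ycoord q j\<close>, and
  the j-th y-direction gives \<open>- 2 * xcoord q j\<close>.\<close>

lemma horizontal_space_imp_heis_form:
  fixes q w :: "'n::finite heisenberg"
  assumes "w \<in> horizontal_space q"
  shows "snd w = heis_form (fst w) (fst q)"
proof -
  interpret bounded_bilinear "heis_form :: (real \<times> real) ^ 'n \<Rightarrow> _"
    by (rule bounded_bilinear_heis_form)
  \<comment> \<open>These move the projections inside the case distinction in
    \<open>axis_def\<close>, so that the sum in \<open>heis_form\<close> collapses to a single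
    index.\<close>
  have fst_if: "fst (if P then u else v) = (if P then fst u else fst v)"
    and snd_if: "snd (if P then u else v) = (if P then snd u else snd v)"
    for P and u v :: "real \<times> real" by simp_all
  show ?thesis
    using assms unfolding horizontal_space_def
  proof (induction rule: span_induct_alt)
    case base
    then show ?case by (simp add: zero_left)
  next
    case (step c x y)
    have "snd x = heis_form (fst x) (fst q)"
      using step(1)
      by (auto simp: X_field_def Y_field_def heis_form_def xcoord_def ycoord_def axis_def
          fst_if snd_if if_distrib[of "\<lambda>x. x * _"] if_distrib[of "\<lambda>x. _ * x"] sum_subtractf
          sum_negf cong: if_cong)
    then show ?case
      using step by (simp add: add_left scaleR_left)
  qed
qed

theorem proposition1p4:
  fixes U K :: "real set"
    and \<Gamma> :: "real \<Rightarrow> 'n::finite heisenberg"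
    and f g :: "'n \<Rightarrow> real \<Rightarrow> real"
    and h :: "real \<Rightarrow> real"
  assumes "open U"
    and "\<forall>s\<in>U. \<Gamma> s = ((\<chi> j. (f j s, g j s)), h s)"
    and "\<Gamma> C1_differentiable_on U"
    and "horizontal_on \<Gamma> U"
    and "compact K"
    and "K \<subseteq> U"
  shows "\<forall>\<epsilon>>0. \<exists>\<delta>>0. \<forall>a\<in>K. \<forall>b\<in>K. 0 < \<bar>b - a\<bar> \<and> \<bar>b - a\<bar> < \<delta> \<longrightarrow>
           \<bar>h b - h a - 2 * (\<Sum>j\<in>UNIV. f j b * g j a - f j a * g j b)\<bar> / \<bar>b - a\<bar>\<^sup>2 < \<epsilon>"
proof (intro allI impI)
  fix \<epsilon> :: real assume "\<epsilon> > 0"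
  define \<Gamma>' where "\<Gamma>' s = vector_derivative \<Gamma> (at s)" for s
  have deriv: "(\<Gamma> has_vector_derivative \<Gamma>' s) (at s)" if "s \<in> U" for s
    using assms(3) that by (simp add: C1_differentiable_on_eq \<Gamma>'_def vector_derivative_works)
  have cont: "continuous_on U \<Gamma>'"
    using assms(3) by (simp add: C1_differentiable_on_eq \<Gamma>'_def[abs_def])
  have horiz: "snd (\<Gamma>' s) = heis_form (fst (\<Gamma>' s)) (fst (\<Gamma> s))" if "s \<in> U" for s
    using assms(4) that by (simp add: horizontal_on_def \<Gamma>'_def horizontal_space_imp_heis_form)
  \<comment> \<open>Halving \<open>\<epsilon>\<close> turns the non-strict bound into the required
    strict one. The components of \<open>\<Gamma>\<close> itself are used here because
    \<open>f\<close>, \<open>g\<close>, \<open>h\<close> are tied to \<open>\<Gamma>\<close> only on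
    \<open>U\<close>; they return once \<open>a\<close> and \<open>b\<close> are fixed in
    \<open>K\<close>.\<close>
  obtain \<delta> where "\<delta> > 0" and \<delta>: "\<And>a b. a \<in> K \<Longrightarrow> \<bar>b - a\<bar> < \<delta> \<Longrightarrow>
      norm (snd (\<Gamma> b) - snd (\<Gamma> a) - heis_form (fst (\<Gamma> b)) (fst (\<Gamma> a))) \<le> \<epsilon> / 2 * \<bar>b - a\<bar>\<^sup>2"
  proof (rule uniform_second_order_alternating[OF bounded_bilinear_heis_form heis_form_self
        assms(1,5,6), where \<epsilon> = "\<epsilon> / 2" and p = "\<lambda>s. fst (\<Gamma> s)" and p' = "\<lambda>s. fst (\<Gamma>' s)"
        and h = "\<lambda>s. snd (\<Gamma> s)"])
    fix s assume "s \<in> U"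
    show "((\<lambda>s. fst (\<Gamma> s)) has_vector_derivative fst (\<Gamma>' s)) (at s)"
      using bounded_linear.has_vector_derivative[OF bounded_linear_fst deriv[OF \<open>s \<in> U\<close>]] .
    show "((\<lambda>s. snd (\<Gamma> s)) has_vector_derivative heis_form (fst (\<Gamma>' s)) (fst (\<Gamma> s))) (at s)"
      using bounded_linear.has_vector_derivative[OF bounded_linear_snd deriv[OF \<open>s \<in> U\<close>]]
      by (simp add: horiz[OF \<open>s \<in> U\<close>])
  qed (use cont \<open>\<epsilon> > 0\<close> in \<open>auto intro: continuous_on_fst\<close>)
  show "\<exists>\<delta>>0. \<forall>a\<in>K. \<forall>b\<in>K. 0 < \<bar>b - a\<bar> \<and> \<bar>b - a\<bar> < \<delta> \<longrightarrow>
      \<bar>h b - h a - 2 * (\<Sum>j\<in>UNIV. f j b * g j a - f j a * g j b)\<bar> / \<bar>b - a\<bar>\<^sup>2 < \<epsilon>"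
  proof (intro exI[of _ \<delta>] conjI ballI impI)
    fix a b assume "a \<in> K" "b \<in> K" and ab: "0 < \<bar>b - a\<bar> \<and> \<bar>b - a\<bar> < \<delta>"
    have \<Gamma>: "\<Gamma> a = ((\<chi> j. (f j a, g j a)), h a)" "\<Gamma> b = ((\<chi> j. (f j b, g j b)), h b)"
      using assms(2,6) \<open>a \<in> K\<close> \<open>b \<in> K\<close> by blast+
    have "\<bar>h b - h a - 2 * (\<Sum>j\<in>UNIV. f j b * g j a - f j a * g j b)\<bar> \<le> \<epsilon> / 2 * \<bar>b - a\<bar>\<^sup>2"
      using \<delta>[OF \<open>a \<in> K\<close>, of b] ab by (simp add: \<Gamma> heis_form_def)
    also have "\<dots> < \<epsilon> * \<bar>b - a\<bar>\<^sup>2"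
      using \<open>\<epsilon> > 0\<close> ab by (intro mult_strict_right_mono) auto
    finally show "\<bar>h b - h a - 2 * (\<Sum>j\<in>UNIV. f j b * g j a - f j a * g j b)\<bar> / \<bar>b - a\<bar>\<^sup>2 < \<epsilon>"
      using ab by (subst pos_divide_less_eq) (auto simp only: zero_less_power)
  qed (rule \<open>\<delta> > 0\<close>)
qed

end
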